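(* Let $S=(S(t))_{t\ge0}$ be a sublinear and monotone $C_0$-semigroup on $X$. Then the symmetric Lipschitz set $D_L^s$ is a linear subspace of $X$. If \[-S(s)\big(-S(t)x\big)\ge S(t)\big(-S(s)(-x)\big)\quad\text{for all }s,t\ge0\text{ and }x\in X,\] then $S(t)x\in D_L^s$ for all $t\ge0$ and $x\in D_L^s$.
   Context: Standing setting: $X$ is a real Banach lattice which is a Riesz subspace of a Dedekind $\sigma$-complete Riesz space $\overline X$. For a sequence $(x_n)_{n\in\mathbb{N}}$, write $x_n\downarrow x$ if $(x_n)$ is decreasing, bounded from below (by an element of $X$), and $x=\inf_n x_n\in\overline X$. Let $X_\delta:=\{x\in\overline X\colon x_n\downarrow x \text{ for some sequence }(x_n)_{n\in\mathbb{N}}\text{ in }X\}$. Let $M$ be the space of all positive linear functionals $\mu\colon X\to\mathbb{R}$ that are continuous from above, i.e. $\mu x_n\downarrow 0$ for every sequence $(x_n)$ in $X$ with $x_n\downarrow 0$; each such $\mu$ extends uniquely to $X_\delta\to\mathbb{R}$ continuously from above, and $M$ is assumed to separate the points of $X_\delta$. An operator $T\colon X\to X$ is sublinear if it is convex ($T(\lambda x+(1-\lambda)y)\le\lambda Tx+(1-\lambda)Ty$ for $\lambda\in[0,1]$) and positive homogeneous ($T(\lambda x)=\lambda Tx$ for $\lambda>0$); monotone if $x\le y$ implies $Tx\le Ty$; bounded if $\sup_{\|x\|\le r}\|Tx\|<\infty$ for all $r>0$. A $C_0$-semigroup on $X$ is a family $S=(S(t))_{t\ge0}$ of bounded (possibly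 nonlinear) operators $X\to X$ with $S(0)x=x$, $S(t+s)x=S(t)S(s)x$ for all $s,t\ge0$, and $S(t)x\to x$ in norm as $t\downarrow 0$, for all $x\in X$. It is sublinear (monotone) if each $S(t)$ is. The Lipschitz set is $D_L:=\{x\in X\colon \sup_{h\in(0,h_0]}\|\frac{S(h)x-x}{h}\|<\infty\text{ for some }h_0>0\}$ and the symmetric Lipschitz set is $D_L^s:=\{x\in X\colon x,-x\in D_L\}$. *)

theory Defs
  imports "HOL-Analysis.Analysis"
begin

class riesz_space = ordered_real_vector + lattice

class dedekind_sigma_complete_riesz_space = riesz_space +
  assumes countable_has_sup:
    "countable A \<Longrightarrow> A \<noteq> {} \<Longrightarrow> (\<And>a. a \<in> A \<Longrightarrow> a \<le> b) \<Longrightarrow>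
      \<exists>s. (\<forall>a\<in>A. a \<le> s) \<and> (\<forall>c. (\<forall>a\<in>A. a \<le> c) \<longrightarrow> s \<le> c)"

text \<open>The modulus of \<open>x\<close> is written out as \<open>sup x (- x)\<close>.\<close>

class banach_lattice = banach + riesz_space +
  assumes lattice_norm: "sup x (- x) \<le> sup y (- y) \<Longrightarrow> norm x \<le> norm y"

text \<open>
  The Banach lattice \<open>X\<close> is the type \<open>'a\<close>, the surrounding Riesz space is the type \<open>'b\<close>, and the
  inclusion of \<open>X\<close> as a Riesz subspace is an injective linear lattice homomorphism
  \<open>\<iota> :: 'a \<Rightarrow> 'b\<close>.
\<close>

definition riesz_embedding :: "('a::riesz_space \<Rightarrow> 'b::riesz_space) \<Rightarrow> bool" where
  "riesz_embedding \<iota> \<longleftrightarrow> linear \<iota> \<and> inj \<iota> \<and>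
     (\<forall>x y. \<iota> (sup x y) = sup (\<iota> x) (\<iota> y)) \<and> (\<forall>x y. \<iota> (inf x y) = inf (\<iota> x) (\<iota> y))"

definition decreases_to ::
  "('a::riesz_space \<Rightarrow> 'b::riesz_space) \<Rightarrow> (nat \<Rightarrow> 'b) \<Rightarrow> 'b \<Rightarrow> bool" where
  "decreases_to \<iota> y l \<longleftrightarrow> decseq y \<and> (\<exists>b. \<forall>n. \<iota> b \<le> y n) \<and>
     (\<forall>n. l \<le> y n) \<and> (\<forall>c. (\<forall>n. c \<le> y n) \<longrightarrow> c \<le> l)"

definition X_delta :: "('a::riesz_space \<Rightarrow> 'b::riesz_space) \<Rightarrow> 'b set" where
  "X_delta \<iota> = {y. \<exists>x :: nat \<Rightarrow> 'a. decreases_to \<iota> (\<lambda>n. \<iota> (x n)) y}"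

definition M_functionals :: "('a::riesz_space \<Rightarrow> 'b::riesz_space) \<Rightarrow> ('a \<Rightarrow> real) set" where
  "M_functionals \<iota> = {\<mu>. linear \<mu> \<and> (\<forall>x\<ge>0. 0 \<le> \<mu> x) \<and>
     (\<forall>x :: nat \<Rightarrow> 'a. decreases_to \<iota> (\<lambda>n. \<iota> (x n)) 0 \<longrightarrow>
        decseq (\<lambda>n. \<mu> (x n)) \<and> (\<lambda>n. \<mu> (x n)) \<longlonglongrightarrow> 0)}"

text \<open>
  \<open>\<nu>\<close> extends \<open>\<mu>\<close> to \<open>X_delta \<iota>\<close> continuously from above. The values of \<open>\<nu>\<close> off \<open>X_delta \<iota>\<close> are
  irrelevant; on \<open>X_delta \<iota>\<close> the extension exists and is unique, see
  \<open>delta_extension_exists\<close> and \<open>delta_extension_unique\<close> below.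
\<close>

definition delta_extension ::
  "('a::riesz_space \<Rightarrow> 'b::riesz_space) \<Rightarrow> ('a \<Rightarrow> real) \<Rightarrow> ('b \<Rightarrow> real) \<Rightarrow> bool" where
  "delta_extension \<iota> \<mu> \<nu> \<longleftrightarrow> (\<forall>x. \<nu> (\<iota> x) = \<mu> x) \<and>
     (\<forall>y l. (\<forall>n. y n \<in> X_delta \<iota>) \<longrightarrow> l \<in> X_delta \<iota> \<longrightarrow> decreases_to \<iota> y l \<longrightarrow>
        decseq (\<lambda>n. \<nu> (y n)) \<and> (\<lambda>n. \<nu> (y n)) \<longlonglongrightarrow> \<nu> l)"

definition M_separates_X_delta :: "('a::riesz_space \<Rightarrow> 'b::riesz_space) \<Rightarrow> bool" where
  "M_separates_X_delta \<iota> \<longleftrightarrow> (\<forall>y\<in>X_delta \<iota>. \<forall>z\<in>X_delta \<iota>. y \<noteq> z \<longrightarrow>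
     (\<exists>\<mu>\<in>M_functionals \<iota>. \<exists>\<nu>. delta_extension \<iota> \<mu> \<nu> \<and> \<nu> y \<noteq> \<nu> z))"

definition convex_operator :: "('a::riesz_space \<Rightarrow> 'a) \<Rightarrow> bool" where
  "convex_operator T \<longleftrightarrow> (\<forall>x y. \<forall>a\<in>{0..1}.
     T (a *\<^sub>R x + (1 - a) *\<^sub>R y) \<le> a *\<^sub>R T x + (1 - a) *\<^sub>R T y)"

definition positive_homogeneous :: "('a::real_vector \<Rightarrow> 'a) \<Rightarrow> bool" where
  "positive_homogeneous T \<longleftrightarrow> (\<forall>x. \<forall>a>0. T (a *\<^sub>R x) = a *\<^sub>R T x)"

definition sublinear_operator :: "('a::riesz_space \<Rightarrow> 'a) \<Rightarrow> bool" where
  "sublinear_operator T \<longleftrightarrow> convex_operator T \<and> positive_homogeneous T"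

definition bounded_operator :: "('a::real_normed_vector \<Rightarrow> 'a) \<Rightarrow> bool" where
  "bounded_operator T \<longleftrightarrow> (\<forall>r>0. bdd_above ((\<lambda>x. norm (T x)) ` {x. norm x \<le> r}))"

text \<open>Semigroups are functions of a real parameter of which only the values at \<open>t \<ge> 0\<close> matter.\<close>

definition C0_semigroup :: "(real \<Rightarrow> 'a::real_normed_vector \<Rightarrow> 'a) \<Rightarrow> bool" where
  "C0_semigroup S \<longleftrightarrow> (\<forall>t\<ge>0. bounded_operator (S t)) \<and> (\<forall>x. S 0 x = x) \<and>
     (\<forall>s\<ge>0. \<forall>t\<ge>0. \<forall>x. S (t + s) x = S t (S s x)) \<and>
     (\<forall>x. ((\<lambda>t. S t x) \<longlongrightarrow> x) (at_right 0))"

definition Lipschitz_set :: "(real \<Rightarrow> 'a::real_normed_vector \<Rightarrow> 'a) \<Rightarrow> 'a set" where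
  "Lipschitz_set S =
     {x. \<exists>h0>0. bdd_above ((\<lambda>h. norm ((S h x - x) /\<^sub>R h)) ` {0<..h0})}"

definition sym_Lipschitz_set :: "(real \<Rightarrow> 'a::real_normed_vector \<Rightarrow> 'a) \<Rightarrow> 'a set" where
  "sym_Lipschitz_set S = {x. x \<in> Lipschitz_set S \<and> - x \<in> Lipschitz_set S}"

lemma riesz_embedding_le_iff:
  assumes "riesz_embedding \<iota>"
  shows "\<iota> x \<le> \<iota> y \<longleftrightarrow> x \<le> y"
proof -
  have "inj \<iota>" and "\<iota> (sup x y) = sup (\<iota> x) (\<iota> y)"
    using assms unfolding riesz_embedding_def by blast+
  then show ?thesis
    unfolding le_iff_sup by (metis injD)
qed

lemma image_in_X_delta: "\<iota> x \<in> X_delta \<iota>"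
  unfolding X_delta_def decreases_to_def
  by (auto intro!: exI[of _ "\<lambda>_. x"])

lemma delta_extension_unique:
  assumes "delta_extension \<iota> \<mu> \<nu>" "delta_extension \<iota> \<mu> \<nu>'" "y \<in> X_delta \<iota>"
  shows "\<nu> y = \<nu>' y"
proof -
  obtain x where x: "decreases_to \<iota> (\<lambda>n. \<iota> (x n)) y"
    using assms(3) unfolding X_delta_def by auto
  have lim: "(\<lambda>n. \<rho> (\<iota> (x n))) \<longlonglongrightarrow> \<rho> y" if "delta_extension \<iota> \<mu> \<rho>" for \<rho>
    using that[unfolded delta_extension_def, THEN conjunct2, rule_format, OF image_in_X_delta assms(3) x]
    by (rule conjunct2)
  have "(\<lambda>n. \<nu> (\<iota> (x n))) \<longlonglongrightarrow> \<nu> y" "(\<lambda>n. \<nu>' (\<iota> (x n))) \<longlonglongrightarrow> \<nu>' y"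
    using lim assms by auto
  moreover have "\<nu> (\<iota> (x n)) = \<nu>' (\<iota> (x n))" for n
    using assms unfolding delta_extension_def by simp
  ultimately show ?thesis
    using LIMSEQ_unique by auto
qed

lemma decreases_to_sup:
  fixes \<iota> :: "'a::riesz_space \<Rightarrow> 'b::riesz_space"
  assumes "decreases_to \<iota> y l"
  shows "decreases_to \<iota> (\<lambda>n. sup (y n) z) (sup l z)"
proof -
  have c: "c \<le> sup l z" if "\<And>n. c \<le> sup (y n) z" for c
  proof -
    have "c - sup 0 (z - l) \<le> y n" for n
    proof -
      have "z + l \<le> z + y n"
        using assms by (intro add_left_mono) (auto simp: decreases_to_def)
      then have "z \<le> y n + (z - l)"
        by (simp add: algebra_simps)
      also have "\<dots> \<le> y n + sup 0 (z - l)"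
        by (intro add_left_mono) simp
      finally have "z \<le> y n + sup 0 (z - l)" .
      moreover have "y n \<le> y n + sup 0 (z - l)"
        using add_left_mono[of 0 "sup 0 (z - l)" "y n"] by simp
      ultimately have "sup (y n) z \<le> y n + sup 0 (z - l)"
        by simp
      with that[of n] have "c \<le> y n + sup 0 (z - l)"
        by (rule order_trans)
      then show ?thesis
        by (simp add: algebra_simps)
    qed
    then have "c - sup 0 (z - l) \<le> l"
      using assms by (simp add: decreases_to_def)
    then have "c \<le> l + sup 0 (z - l)"
      by (simp add: algebra_simps)
    also have "\<dots> \<le> sup l z"
    proof -
      have "sup 0 (z - l) \<le> sup l z - l"
        by (rule le_supI) (simp_all add: diff_right_mono)
      then show ?thesis
        by (simp add: algebra_simps)
    qed
    finally show ?thesis .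
  qed
  have "decseq (\<lambda>n. sup (y n) z)"
    using assms unfolding decreases_to_def decseq_def by (auto intro: le_supI1)
  moreover have "\<exists>b. \<forall>n. \<iota> b \<le> sup (y n) z"
    using assms unfolding decreases_to_def by (auto intro: le_supI1)
  moreover have "sup l z \<le> sup (y n) z" for n
    using assms unfolding decreases_to_def by (auto intro: le_supI1)
  ultimately show ?thesis
    using c unfolding decreases_to_def by blast
qed

lemma decreases_to_diff:
  assumes "riesz_embedding \<iota>" "decreases_to \<iota> y l"
  shows "decreases_to \<iota> (\<lambda>n. y n - \<iota> z) (l - \<iota> z)"
proof -
  obtain b where b: "\<And>n. \<iota> b \<le> y n"
    using assms(2) unfolding decreases_to_def by auto
  have "\<iota> (b - z) = \<iota> b - \<iota> z"
    using assms(1) by (simp add: riesz_embedding_def linear_diff)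
  then have "\<forall>n. \<iota> (b - z) \<le> y n - \<iota> z"
    using b by (simp add: diff_right_mono)
  moreover have "c \<le> l - \<iota> z" if "\<forall>n. c \<le> y n - \<iota> z" for c
  proof -
    have "\<forall>n. c + \<iota> z \<le> y n"
      using that by (simp add: algebra_simps)
    then have "c + \<iota> z \<le> l"
      using assms(2) unfolding decreases_to_def by blast
    then show ?thesis
      by (simp add: algebra_simps)
  qed
  ultimately show ?thesis
    using assms(2) unfolding decreases_to_def decseq_def
    by (auto simp: diff_right_mono)
qed

lemma delta_extension_exists:
  fixes \<iota> :: "'a::riesz_space \<Rightarrow> 'b::riesz_space"
  assumes emb: "riesz_embedding \<iota>" and \<mu>: "\<mu> \<in> M_functionals \<iota>"
  shows "\<exists>\<nu>. delta_extension \<iota> \<mu> \<nu>"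
proof -
  have lin: "linear \<mu>" and lin': "linear \<iota>"
    using \<mu> emb by (auto simp: M_functionals_def riesz_embedding_def)
  have mono: "\<mu> x \<le> \<mu> y" if "x \<le> y" for x y
  proof -
    have "0 \<le> \<mu> (y - x)"
      using \<mu> that by (simp add: M_functionals_def)
    then show ?thesis
      by (simp add: linear_diff[OF lin])
  qed
  have le: "\<iota> x \<le> \<iota> y \<longleftrightarrow> x \<le> y" for x y
    using riesz_embedding_le_iff[OF emb] .
  have sup': "\<iota> (sup x y) = sup (\<iota> x) (\<iota> y)" and inf': "\<iota> (inf x y) = inf (\<iota> x) (\<iota> y)" for x y
    using emb by (auto simp: riesz_embedding_def)
  define \<nu> where "\<nu> y = Inf (\<mu> ` {x. y \<le> \<iota> x})" for y
  have bdd: "bdd_below (\<mu> ` {x. y \<le> \<iota> x})" if y: "y \<in> X_delta \<iota>" for y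
  proof -
    obtain x where "decreases_to \<iota> (\<lambda>n. \<iota> (x n)) y"
      using y unfolding X_delta_def by auto
    then obtain b where "\<iota> b \<le> y"
      unfolding decreases_to_def by auto
    then have "\<mu> b \<le> \<mu> z" if "y \<le> \<iota> z" for z
      using that le mono order_trans by blast
    then show ?thesis
      by (intro bdd_belowI[of _ "\<mu> b"]) auto
  qed
  have ne: "{x. y \<le> \<iota> x} \<noteq> {}" if y: "y \<in> X_delta \<iota>" for y
    using y unfolding X_delta_def decreases_to_def by auto
  have \<nu>_le: "\<nu> y \<le> \<mu> x" if "y \<in> X_delta \<iota>" "y \<le> \<iota> x" for x y
    unfolding \<nu>_def using that bdd by (intro cInf_lower) auto
  have \<nu>_mono: "\<nu> y \<le> \<nu> z" if "y \<in> X_delta \<iota>" "z \<in> X_delta \<iota>" "y \<le> z" for y z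
    unfolding \<nu>_def using that bdd ne by (intro cInf_superset_mono) (auto intro: order_trans)
  have lim: "(\<lambda>n. \<mu> (x n)) \<longlonglongrightarrow> \<nu> y" if x: "decreases_to \<iota> (\<lambda>n. \<iota> (x n)) y" for x y
  proof -
    have y: "y \<in> X_delta \<iota>"
      using x unfolding X_delta_def by auto
    show ?thesis
    proof (rule LIMSEQ_I)
      fix r :: real assume r: "0 < r"
      obtain z where z: "y \<le> \<iota> z" "\<mu> z < \<nu> y + r / 2"
        using cInf_lessD[of "\<mu> ` {x. y \<le> \<iota> x}" "\<nu> y + r / 2"] ne[OF y] r
        unfolding \<nu>_def by auto
      have "decreases_to \<iota> (\<lambda>n. sup (\<iota> (x n)) (\<iota> z) - \<iota> z) (sup y (\<iota> z) - \<iota> z)"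
        using decreases_to_diff[OF emb decreases_to_sup[OF x]] .
      then have "decreases_to \<iota> (\<lambda>n. \<iota> (sup (x n) z - z)) 0"
        using z(1) by (simp add: sup' linear_diff[OF lin'] sup_absorb2)
      then have "(\<lambda>n. \<mu> (sup (x n) z - z)) \<longlonglongrightarrow> 0"
        using \<mu> by (simp add: M_functionals_def)
      then obtain N where N: "\<And>n. n \<ge> N \<Longrightarrow> norm (\<mu> (sup (x n) z - z) - 0) < r / 2"
        using LIMSEQ_D[of "\<lambda>n. \<mu> (sup (x n) z - z)" 0 "r / 2"] r by auto
      have "norm (\<mu> (x n) - \<nu> y) < r" if "n \<ge> N" for n
      proof -
        have "\<mu> (x n) \<le> \<mu> (sup (x n) z)"
          by (rule mono) simp
        moreover have "\<mu> (sup (x n) z) < \<mu> z + r / 2"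
          using N[OF that] by (simp add: linear_diff[OF lin] abs_if split: if_splits)
        moreover have "\<nu> y \<le> \<mu> (x n)"
          using x by (intro \<nu>_le[OF y]) (simp add: decreases_to_def)
        ultimately show ?thesis
          using z(2) by simp
      qed
      then show "\<exists>N. \<forall>n\<ge>N. norm (\<mu> (x n) - \<nu> y) < r"
        by blast
    qed
  qed
  have ext: "\<nu> (\<iota> x) = \<mu> x" for x
  proof -
    have "decreases_to \<iota> (\<lambda>n. \<iota> x) (\<iota> x)"
      unfolding decreases_to_def by auto
    from lim[of "\<lambda>_. x", OF this] show ?thesis
      by (simp add: LIMSEQ_const_iff)
  qed
  have cont: "decseq (\<lambda>n. \<nu> (y n)) \<and> (\<lambda>n. \<nu> (y n)) \<longlonglongrightarrow> \<nu> l"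
    if y: "\<And>n. y n \<in> X_delta \<iota>" and l: "l \<in> X_delta \<iota>" and d: "decreases_to \<iota> y l" for y l
  proof
    show "decseq (\<lambda>n. \<nu> (y n))"
      using d y unfolding decreases_to_def decseq_def by (auto intro: \<nu>_mono)
    have "\<forall>n. \<exists>x. decreases_to \<iota> (\<lambda>k. \<iota> (x k)) (y n)"
      using y unfolding X_delta_def by auto
    then obtain x where x: "\<And>n. decreases_to \<iota> (\<lambda>k. \<iota> (x n k)) (y n)"
      by metis
    define z where "z n = Inf_fin ((\<lambda>i. x i n) ` {..n})" for n
    have z_le: "z n \<le> x i n" if "i \<le> n" for i n
      unfolding z_def using that by (intro Inf_fin.coboundedI) auto
    have z_ge: "y n \<le> \<iota> (z n)" for n
    proof -
      have glb: "c \<le> \<iota> (Inf_fin A)"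
        if "finite A" "A \<noteq> {}" "\<forall>a\<in>A. c \<le> \<iota> a" for A c
        using that by (induction A rule: finite_ne_induct) (auto simp: inf')
      have "y n \<le> \<iota> (x i n)" if "i \<le> n" for i
      proof -
        have "y n \<le> y i"
          using d that unfolding decreases_to_def decseq_def by blast
        also have "y i \<le> \<iota> (x i n)"
          using x unfolding decreases_to_def by blast
        finally show ?thesis .
      qed
      then show ?thesis
        unfolding z_def by (intro glb) auto
    qed
    have x_dec: "x i m \<le> x i n" if "n \<le> m" for i m n
      using x[of i] that le unfolding decreases_to_def decseq_def by blast
    have z_dec: "z m \<le> z n" if nm: "n \<le> m" for m n
    proof -
      have "z m \<le> x i n" if "i \<le> n" for i
        using order_trans[OF z_le[of i m] x_dec[OF nm, of i]] that nm by simp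
      then show ?thesis
        unfolding z_def[of n] by (intro Inf_fin.boundedI) auto
    qed
    have "c \<le> l" if c: "\<forall>n. c \<le> \<iota> (z n)" for c
    proof -
      have "c \<le> \<iota> (x i k)" for i k
      proof -
        have "c \<le> \<iota> (z (max i k))"
          using c by blast
        also have "\<dots> \<le> \<iota> (x i k)"
          unfolding le using order_trans[OF z_le[of i "max i k"] x_dec[of k "max i k" i]] by simp
        finally show ?thesis .
      qed
      then have "c \<le> y i" for i
        using x[of i] unfolding decreases_to_def by blast
      then show ?thesis
        using d unfolding decreases_to_def by blast
    qed
    moreover have "\<exists>b. \<forall>n. \<iota> b \<le> \<iota> (z n)"
      using d z_ge unfolding decreases_to_def by (meson order_trans)
    moreover have "\<forall>n. l \<le> \<iota> (z n)"
      using d z_ge unfolding decreases_to_def by (meson order_trans)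
    ultimately have "decreases_to \<iota> (\<lambda>n. \<iota> (z n)) l"
      unfolding decreases_to_def decseq_def using z_dec le by blast
    then have up: "(\<lambda>n. \<mu> (z n)) \<longlonglongrightarrow> \<nu> l"
      by (rule lim)
    have "\<nu> l \<le> \<nu> (y n)" for n
      using d l y unfolding decreases_to_def by (intro \<nu>_mono) auto
    moreover have "\<nu> (y n) \<le> \<mu> (z n)" for n
      by (rule \<nu>_le[OF y z_ge])
    ultimately show "(\<lambda>n. \<nu> (y n)) \<longlonglongrightarrow> \<nu> l"
      by (intro tendsto_sandwich[OF _ _ tendsto_const up] always_eventually allI)
  qed
  have "delta_extension \<iota> \<mu> \<nu>"
    unfolding delta_extension_def using ext cont by blast
  then show ?thesis
    by blast
qed

end

theory Submission
  imports Defs "HOL-Library.Landau_Symbols"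
begin

text \<open>
  Subadditivity encloses the increments \<open>S h z - z\<close> in order intervals whose endpoints are controlled
  by assumption, and the lattice norm turns this into a norm bound. For a sum,
  \<open>(S h x - x) - (S h (- y) + y) \<le> S h (x + y) - (x + y) \<le> (S h x - x) + (S h y - y)\<close>.
  Every \<open>S t\<close> is Lipschitz continuous, which bounds \<open>S h (S t x) - S t x = S t (S h x) - S t x\<close>.
  For \<open>- S t x\<close> the commutation inequality gives
  \<open>S t x - S h (S t x) \<le> S h (- S t x) + S t x \<le> S t x - S t (- S h (- x))\<close>.
\<close>

lemma modulus_nonneg: "0 \<le> sup x (- x)" for x :: "'a::riesz_space"
proof -
  have "x + - x \<le> sup x (- x) + sup x (- x)"
    by (intro add_mono) simp_all
  then have "0 \<le> (1/2) *\<^sub>R (sup x (- x) + sup x (- x))"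
    by (intro scaleR_nonneg_nonneg) simp_all
  also have "\<dots> = sup x (- x)"
    by (simp flip: scaleR_2)
  finally show ?thesis .
qed

text \<open>The modulus is nonnegative, hence equal to its own modulus, so
  \<open>lattice_norm\<close> applies in both directions.\<close>

lemma norm_modulus: "norm (sup x (- x)) = norm x" for x :: "'a::banach_lattice"
proof -
  have "sup (sup x (- x)) (- sup x (- x)) = sup x (- x)"
    using modulus_nonneg[of x] by (intro sup_absorb1) (simp add: order_trans[of _ 0])
  then show ?thesis
    by (intro antisym lattice_norm) simp_all
qed

text \<open>Both \<open>z\<close> and \<open>- z\<close> lie below the nonnegative element
  \<open>?w\<close>, the sum of the moduli of \<open>a\<close> and \<open>b\<close>; so does the
  modulus of \<open>z\<close>, and the norm is monotone in the modulus.\<close>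

lemma norm_le_of_order_interval:
  fixes a b z :: "'a::banach_lattice"
  assumes "a \<le> z" "z \<le> b"
  shows "norm z \<le> norm a + norm b"
proof -
  let ?w = "sup a (- a) + sup b (- b)"
  have "z \<le> sup b (- b)"
    using assms(2) by (rule le_supI1)
  then have "z \<le> ?w"
    using add_mono[OF modulus_nonneg[of a]] by fastforce
  moreover have "- z \<le> sup a (- a)"
    using assms(1) by (intro le_supI2) simp
  then have "- z \<le> ?w"
    using add_mono[OF _ modulus_nonneg[of b]] by fastforce
  ultimately have "sup z (- z) \<le> sup ?w (- ?w)"
    by (intro le_supI1) simp
  then have "norm z \<le> norm ?w"
    by (rule lattice_norm)
  also have "\<dots> \<le> norm a + norm b"
    using norm_triangle_ineq[of "sup a (- a)" "sup b (- b)"] by (simp add: norm_modulus)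
  finally show ?thesis .
qed

text \<open>Homogeneity is postulated for scalars \<open>a > 0\<close> only, so the value at zero
  comes from \<open>T 0 = 2 *\<^sub>R T 0\<close>.\<close>

lemma positive_homogeneous_zero:
  assumes "positive_homogeneous T"
  shows "T 0 = 0"
proof -
  have "T (2 *\<^sub>R 0) = 2 *\<^sub>R T 0"
    using assms unfolding positive_homogeneous_def by (metis zero_less_numeral)
  then show ?thesis
    by (simp add: scaleR_2)
qed

text \<open>Convexity at the midpoint of \<open>2 *\<^sub>R x\<close> and
  \<open>2 *\<^sub>R y\<close>; homogeneity cancels the factor 2.\<close>

lemma sublinear_operator_add_le:
  assumes "sublinear_operator T"
  shows "T (x + y) \<le> T x + T y"
proof -
  have hom: "T (2 *\<^sub>R z) = 2 *\<^sub>R T z" for z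
    using assms unfolding sublinear_operator_def positive_homogeneous_def by simp
  have "\<forall>a\<in>{0..1}. T (a *\<^sub>R (2 *\<^sub>R x) + (1 - a) *\<^sub>R (2 *\<^sub>R y))
      \<le> a *\<^sub>R T (2 *\<^sub>R x) + (1 - a) *\<^sub>R T (2 *\<^sub>R y)"
    using assms unfolding sublinear_operator_def convex_operator_def by blast
  then have "T ((1/2) *\<^sub>R (2 *\<^sub>R x) + (1 - 1/2) *\<^sub>R (2 *\<^sub>R y))
      \<le> (1/2) *\<^sub>R T (2 *\<^sub>R x) + (1 - 1/2) *\<^sub>R T (2 *\<^sub>R y)"
    by (rule bspec) simp
  then show ?thesis
    by (simp add: hom)
qed

lemma sublinear_operator_diff_le:
  assumes "sublinear_operator T"
  shows "T x - T y \<le> T (x - y)"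
  using sublinear_operator_add_le[OF assms, of "x - y" y] by (simp add: diff_le_eq)

text \<open>A bound \<open>M\<close> on the unit ball becomes
  \<open>norm (T x) \<le> M * norm x\<close> by scaling. Subadditivity encloses
  \<open>T x - T y\<close> between two values each of norm at most \<open>M * norm (x - y)\<close>,
  whence the constant \<open>2 * M\<close>.\<close>

lemma sublinear_bounded_operator_lipschitz:
  fixes T :: "'a::banach_lattice \<Rightarrow> 'a"
  assumes T: "sublinear_operator T" and "bounded_operator T"
  obtains C where "0 \<le> C" "\<And>x y. norm (T x - T y) \<le> C * norm (x - y)"
proof -
  have hom: "positive_homogeneous T"
    using T by (simp add: sublinear_operator_def)
  have "bdd_above ((\<lambda>x. norm (T x)) ` {x. norm x \<le> 1})"
    using assms(2) by (simp add: bounded_operator_def)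
  then obtain M where M: "\<And>x. norm x \<le> 1 \<Longrightarrow> norm (T x) \<le> M"
    unfolding bdd_above_def by auto
  have "0 \<le> M"
    using order_trans[OF norm_ge_zero M[of 0]] by simp
  have bound: "norm (T x) \<le> M * norm x" for x
  proof (cases "x = 0")
    case True
    then show ?thesis
      by (simp add: positive_homogeneous_zero[OF hom])
  next
    case False
    have "T x = T (norm x *\<^sub>R sgn x)"
      using False by (simp add: sgn_div_norm)
    also have "\<dots> = norm x *\<^sub>R T (sgn x)"
      using hom False by (simp add: positive_homogeneous_def)
    finally have "norm (T x) = norm x * norm (T (sgn x))"
      by simp
    also have "\<dots> \<le> norm x * M"
      by (intro mult_left_mono M) (simp_all add: norm_sgn)
    finally show ?thesis
      by (simp add: mult.commute)
  qed
  have "norm (T x - T y) \<le> 2 * M * norm (x - y)" for x y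
  proof -
    \<comment> \<open>\<open>T\<close> need not be odd, so the lower endpoint comes from exchanging
      \<open>x\<close> and \<open>y\<close>.\<close>
    have "- T (y - x) \<le> T x - T y"
      using le_imp_neg_le[OF sublinear_operator_diff_le[OF T, of y x]] by simp
    then have "norm (T x - T y) \<le> norm (T (y - x)) + norm (T (x - y))"
      using norm_le_of_order_interval sublinear_operator_diff_le[OF T, of x y] by fastforce
    also have "\<dots> \<le> 2 * M * norm (x - y)"
      using bound[of "x - y"] bound[of "y - x"] by (simp add: norm_minus_commute)
    finally show ?thesis .
  qed
  with \<open>0 \<le> M\<close> show ?thesis
    by (intro that[of "2 * M"]) simp_all
qed

text \<open>In this form the quantifiers over \<open>h0\<close> and the bound disappear, and sums
  and multiples are handled by the Landau calculus.\<close>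

lemma Lipschitz_set_iff_bigo:
  "x \<in> Lipschitz_set S \<longleftrightarrow> (\<lambda>h. norm (S h x - x)) \<in> O[at_right 0](\<lambda>h. h)"
proof -
  have "x \<in> Lipschitz_set S \<longleftrightarrow>
      (\<exists>h0>0. \<exists>K. \<forall>h. 0 < h \<longrightarrow> h \<le> h0 \<longrightarrow> norm (S h x - x) \<le> K * h)"
    unfolding Lipschitz_set_def bdd_above_def ball_simps mem_Collect_eq
    by (intro ex_cong1 conj_cong refl)
      (auto simp: divide_le_eq simp flip: divide_inverse_commute)
  also have "\<dots> \<longleftrightarrow> (\<exists>K. \<forall>\<^sub>F h in at_right 0. norm (S h x - x) \<le> K * h)"
  proof
    assume "\<exists>h0>0. \<exists>K. \<forall>h. 0 < h \<longrightarrow> h \<le> h0 \<longrightarrow> norm (S h x - x) \<le> K * h"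
    then show "\<exists>K. \<forall>\<^sub>F h in at_right 0. norm (S h x - x) \<le> K * h"
      unfolding eventually_at_right_field by (meson less_imp_le)
  next
    assume "\<exists>K. \<forall>\<^sub>F h in at_right 0. norm (S h x - x) \<le> K * h"
    then obtain K b where "0 < b" "\<And>h. 0 < h \<Longrightarrow> h < b \<Longrightarrow> norm (S h x - x) \<le> K * h"
      unfolding eventually_at_right_field by auto
    then show "\<exists>h0>0. \<exists>K. \<forall>h. 0 < h \<longrightarrow> h \<le> h0 \<longrightarrow> norm (S h x - x) \<le> K * h"
      \<comment> \<open>The filter gives an estimate on the open interval below \<open>b\<close>,
        whereas \<open>h0\<close> itself must be admissible; hence \<open>b / 2\<close>.\<close>
      by (intro exI[of _ "b / 2"] conjI exI[of _ K]) auto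
  qed
  also have "\<dots> \<longleftrightarrow> (\<exists>K. \<forall>\<^sub>F h in at_right 0. norm (S h x - x) \<le> K * \<bar>h\<bar>)"
    by (intro ex_cong1 eventually_cong[OF eventually_at_right_less[of "0::real"]]) simp
  also have "\<dots> \<longleftrightarrow> (\<lambda>h. norm (S h x - x)) \<in> O[at_right 0](\<lambda>h. h)"
    by (auto intro: bigoI elim!: landau_o.bigE)
  finally show ?thesis .
qed

lemma Lipschitz_set_dominated:
  assumes "g \<in> O[at_right 0](\<lambda>h. h)"
    and le: "\<And>h. 0 < h \<Longrightarrow> norm (S h z - z) \<le> g h"
  shows "z \<in> Lipschitz_set S"
proof -
  have "\<forall>\<^sub>F h in at_right 0. norm (norm (S h z - z)) \<le> norm (g h)"
    by (rule eventually_mono[OF eventually_at_right_less[of "0::real"]])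
      (use le order_trans abs_ge_self in fastforce)
  then show ?thesis
    unfolding Lipschitz_set_iff_bigo by (rule landau_o.big_trans[OF landau_o.big_mono assms(1)])
qed

lemma sym_Lipschitz_set_uminus: "x \<in> sym_Lipschitz_set S \<Longrightarrow> - x \<in> sym_Lipschitz_set S"
  by (simp add: sym_Lipschitz_set_def)

lemma subspace_sym_Lipschitz_set:
  fixes S :: "real \<Rightarrow> 'a::banach_lattice \<Rightarrow> 'a"
  assumes sub: "\<And>t. 0 \<le> t \<Longrightarrow> sublinear_operator (S t)"
  shows "subspace (sym_Lipschitz_set S)"
proof (rule subspaceI)
  have hom: "positive_homogeneous (S h)" if "0 < h" for h
    using sub[of h] that by (simp add: sublinear_operator_def)
  let ?d = "\<lambda>h z. S h z - z"
  have "0 \<in> Lipschitz_set S"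
    by (rule Lipschitz_set_dominated[of "\<lambda>_. 0"]) (simp_all add: positive_homogeneous_zero[OF hom])
  then show zero: "0 \<in> sym_Lipschitz_set S"
    by (simp add: sym_Lipschitz_set_def)
  have add: "x + y \<in> Lipschitz_set S"
    if x: "x \<in> sym_Lipschitz_set S" and y: "y \<in> sym_Lipschitz_set S" for x y
  proof (rule Lipschitz_set_dominated)
    show "norm (?d h (x + y)) \<le>
        (norm (?d h x) + norm (?d h (- y))) + (norm (?d h x) + norm (?d h y))" if "0 < h" for h
    proof -
      have "?d h x - ?d h (- y) \<le> ?d h (x + y)"
        using sublinear_operator_diff_le[OF sub, of h x "- y"] that by (simp add: algebra_simps)
      moreover have "?d h (x + y) \<le> ?d h x + ?d h y"
        using sublinear_operator_add_le[OF sub, of h x y] that by (simp add: algebra_simps)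
      ultimately have "norm (?d h (x + y)) \<le> norm (?d h x - ?d h (- y)) + norm (?d h x + ?d h y)"
        by (rule norm_le_of_order_interval)
      also have "\<dots> \<le> (norm (?d h x) + norm (?d h (- y))) + (norm (?d h x) + norm (?d h y))"
        by (intro add_mono norm_triangle_ineq4 norm_triangle_ineq)
      finally show ?thesis .
    qed
    show "(\<lambda>h. (norm (?d h x) + norm (?d h (- y))) + (norm (?d h x) + norm (?d h y)))
        \<in> O[at_right 0](\<lambda>h. h)"
      using x y unfolding sym_Lipschitz_set_def Lipschitz_set_iff_bigo
      by (intro sum_in_bigo) auto
  qed
  show "x + y \<in> sym_Lipschitz_set S"
    if "x \<in> sym_Lipschitz_set S" "y \<in> sym_Lipschitz_set S" for x y
    \<comment> \<open>The negative of the sum is the sum of \<open>- x\<close> and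
      \<open>- y\<close>.\<close>
    using add[OF that] add[OF that[THEN sym_Lipschitz_set_uminus]]
    by (simp add: sym_Lipschitz_set_def)
  have scale: "a *\<^sub>R x \<in> sym_Lipschitz_set S" if "0 < a" "x \<in> sym_Lipschitz_set S" for a x
  proof -
    have eq: "norm (?d h (a *\<^sub>R z)) = a * norm (?d h z)" if "0 < h" for h z
      using hom[OF that] \<open>0 < a\<close> unfolding positive_homogeneous_def
      by (simp flip: scaleR_diff_right)
    have "a *\<^sub>R z \<in> Lipschitz_set S" if "z \<in> Lipschitz_set S" for z
      using that \<open>0 < a\<close> unfolding Lipschitz_set_iff_bigo[of z]
      by (intro Lipschitz_set_dominated[of "\<lambda>h. a * norm (?d h z)"]) (simp_all add: eq)
    from this[of x] this[of "- x"] that(2) show ?thesis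
      by (simp add: sym_Lipschitz_set_def)
  qed
  show "a *\<^sub>R x \<in> sym_Lipschitz_set S" if "x \<in> sym_Lipschitz_set S" for a x
    \<comment> \<open>A negative multiple of \<open>x\<close> is a positive multiple of
      \<open>- x\<close>, which the symmetric set also contains.\<close>
    using scale[of a x] scale[of "- a" "- x"] sym_Lipschitz_set_uminus[OF that] that zero
    by (cases a "0::real" rule: linorder_cases) simp_all
qed

lemma sym_Lipschitz_set_invariant:
  fixes S :: "real \<Rightarrow> 'a::banach_lattice \<Rightarrow> 'a"
  assumes S: "C0_semigroup S" and sub: "\<And>t. 0 \<le> t \<Longrightarrow> sublinear_operator (S t)"
    and comm: "\<And>s x. 0 \<le> s \<Longrightarrow> S t (- S s (- x)) \<le> - S s (- S t x)"
    and "0 \<le> t" and x: "x \<in> sym_Lipschitz_set S"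
  shows "S t x \<in> sym_Lipschitz_set S"
proof -
  obtain C where "0 \<le> C" and C: "\<And>u v. norm (S t u - S t v) \<le> C * norm (u - v)"
    using sublinear_bounded_operator_lipschitz sub[OF \<open>0 \<le> t\<close>] S \<open>0 \<le> t\<close>
    unfolding C0_semigroup_def by metis
  have pos: "norm (S h (S t x) - S t x) \<le> C * norm (S h x - x)" if "0 < h" for h
  proof -
    \<comment> \<open>By the semigroup law \<open>S h\<close> and \<open>S t\<close> commute, so the
      increment at \<open>S t x\<close> is the image under \<open>S t\<close> of an increment at
      \<open>x\<close>.\<close>
    have "S h (S t x) = S (h + t) x" "S t (S h x) = S (t + h) x"
      using S that \<open>0 \<le> t\<close> unfolding C0_semigroup_def by simp_all
    then have "S h (S t x) = S t (S h x)"
      by (simp add: add.commute)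
    then show ?thesis
      using C[of "S h x" x] by simp
  qed
  have neg: "norm (S h (- S t x) - - S t x)
      \<le> C * norm (S h x - x) + C * norm (S h (- x) - - x)" if "0 < h" for h
  proof -
    \<comment> \<open>Subadditivity applied to \<open>S t x + (- S t x) = 0\<close>, where
      \<open>S h 0 = 0\<close>.\<close>
    have "S t x - S h (S t x) \<le> S h (- S t x) - - S t x"
      using sublinear_operator_add_le[OF sub, of h "S t x" "- S t x"] that
        positive_homogeneous_zero[of "S h"] sub[of h]
      by (simp add: sublinear_operator_def algebra_simps)
    moreover have "S h (- S t x) - - S t x \<le> S t x - S t (- S h (- x))"
      using le_imp_neg_le[OF comm[of h x]] that by simp
    ultimately have "norm (S h (- S t x) - - S t x)
        \<le> norm (S t x - S h (S t x)) + norm (S t x - S t (- S h (- x)))"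
      by (rule norm_le_of_order_interval)
    \<comment> \<open>The second term compares \<open>S t\<close> at \<open>x\<close> and at
      \<open>- S h (- x)\<close>. These points differ by the increment of \<open>- x\<close>, so
      membership of \<open>- x\<close> in the Lipschitz set enters here.\<close>
    also have "\<dots> \<le> C * norm (S h x - x) + C * norm (x - - S h (- x))"
      using pos[OF that] by (intro add_mono C) (simp add: norm_minus_commute)
    finally show ?thesis
      by (simp add: add.commute)
  qed
  let ?d = "\<lambda>h z. norm (S h z - z)"
  have "(\<lambda>h. C * ?d h x) \<in> O[at_right 0](\<lambda>h. h)" "(\<lambda>h. C * ?d h (- x)) \<in> O[at_right 0](\<lambda>h. h)"
    using x by (simp_all add: sym_Lipschitz_set_def Lipschitz_set_iff_bigo)
  then have "S t x \<in> Lipschitz_set S" "- S t x \<in> Lipschitz_set S"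
    using Lipschitz_set_dominated[of "\<lambda>h. C * ?d h x" S "S t x", OF _ pos]
      Lipschitz_set_dominated[of "\<lambda>h. C * ?d h x + C * ?d h (- x)" S "- S t x", OF sum_in_bigo(1) neg]
    by metis+
  then show ?thesis
    by (simp add: sym_Lipschitz_set_def)
qed

theorem proposition3p6:
  fixes \<iota> :: "'a::banach_lattice \<Rightarrow> 'b::dedekind_sigma_complete_riesz_space"
    and S :: "real \<Rightarrow> 'a \<Rightarrow> 'a"
  assumes "riesz_embedding \<iota>"
    and "M_separates_X_delta \<iota>"
    and "C0_semigroup S"
    and "\<forall>t\<ge>0. sublinear_operator (S t)"
    and "\<forall>t\<ge>0. mono (S t)"
  shows "subspace (sym_Lipschitz_set S) \<and>
    ((\<forall>s\<ge>0. \<forall>t\<ge>0. \<forall>x. - S s (- S t x) \<ge> S t (- S s (- x))) \<longrightarrow>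
      (\<forall>t\<ge>0. \<forall>x\<in>sym_Lipschitz_set S. S t x \<in> sym_Lipschitz_set S))"
  using subspace_sym_Lipschitz_set[of S] sym_Lipschitz_set_invariant[of S] assms(3,4) by blast

end
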